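(* Let $A\in\mathbb{R}^{n\times n}$ be an $M$-matrix with property $c$ and let $A=K-L=U-V=X-Y$ be three regular splittings of $A$. If $K+X-A+YU^{-1}L$ is nonsingular and all diagonal entries of $X^{-1}YU^{-1}VK^{-1}L$ are positive, then the matrix $X^{-1}YU^{-1}VK^{-1}L$ is semiconvergent.
   Context: Matrices are real $n\times n$; $\rho$ is the spectral radius; $B\ge 0$ means entrywise nonnegative. A matrix $T$ is semiconvergent if $\lim_{k\to\infty}T^k$ exists (not necessarily zero). $A$ is an $M$-matrix if $A=sI-B$ with $B\ge 0$, $s>0$ and $s\ge\rho(B)$; it has property $c$ if $s^{-1}B$ is semiconvergent for some such representation $A=sI-B$. A splitting $A=U-V$ is an expression with $U$ nonsingular; it is regular if $U^{-1}\ge 0$ and $V\ge 0$. *)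

theory Defs
  imports
    "Jordan_Normal_Form.Spectral_Radius"
    "Jordan_Normal_Form.Gauss_Jordan_Elimination"
begin

text \<open>The library's order on matrices is the entrywise one, so \<open>0\<^sub>m n n \<le> B\<close> says that the
  \<open>n \<times> n\<close> matrix \<open>B\<close> is entrywise nonnegative.\<close>

text \<open>\<open>mat_inverse\<close> is an option, equal to \<open>None\<close> on singular matrices;
  \<open>mat_inv\<close> is meaningful for nonsingular arguments only.\<close>

definition mat_inv :: "real mat \<Rightarrow> real mat" where
  "mat_inv A = the (mat_inverse A)"

lemma mat_inv:
  assumes A: "A \<in> carrier_mat n n" and inv: "invertible_mat A"
  shows "A * mat_inv A = 1\<^sub>m n" "mat_inv A * A = 1\<^sub>m n" "mat_inv A \<in> carrier_mat n n"
proof -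
  from inv obtain B where "inverts_mat A B" "inverts_mat B A"
    unfolding invertible_mat_def by blast
  then have AB: "A * B = 1\<^sub>m n" and BA: "B * A = 1\<^sub>m (dim_row B)"
    using A unfolding inverts_mat_def by auto
  have "dim_col B = n" using arg_cong[OF AB, of dim_col] by simp
  moreover have "dim_row B = n" using arg_cong[OF BA, of dim_col] A by simp
  ultimately have "B \<in> carrier_mat n n" by auto
  then have "A \<in> Units (ring_mat TYPE(real) n ())"
    using A AB BA unfolding Units_def by (auto simp: ring_mat_def)
  then obtain C where C: "mat_inverse A = Some C"
    using mat_inverse(1)[OF A, where b = "()"] by (cases "mat_inverse A") auto
  from mat_inverse(2)[OF A C]
  show "A * mat_inv A = 1\<^sub>m n" "mat_inv A * A = 1\<^sub>m n" "mat_inv A \<in> carrier_mat n n"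
    by (simp_all add: mat_inv_def C)
qed

text \<open>The library has no topology on matrices, hence the limit of the powers is taken entrywise.\<close>

definition semiconvergent :: "nat \<Rightarrow> real mat \<Rightarrow> bool" where
  "semiconvergent n T \<longleftrightarrow> T \<in> carrier_mat n n \<and>
     (\<exists>C \<in> carrier_mat n n. \<forall>i<n. \<forall>j<n. (\<lambda>k. (T ^\<^sub>m k) $$ (i,j)) \<longlonglongrightarrow> C $$ (i,j))"

definition M_representation :: "nat \<Rightarrow> real mat \<Rightarrow> real \<Rightarrow> real mat \<Rightarrow> bool" where
  "M_representation n A s B \<longleftrightarrow>
     B \<in> carrier_mat n n \<and> A = s \<cdot>\<^sub>m 1\<^sub>m n - B \<and> 0\<^sub>m n n \<le> B \<and>
     s > 0 \<and> s \<ge> spectral_radius (map_mat complex_of_real B)"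

definition M_matrix :: "nat \<Rightarrow> real mat \<Rightarrow> bool" where
  "M_matrix n A \<longleftrightarrow> (\<exists>s B. M_representation n A s B)"

definition property_c :: "nat \<Rightarrow> real mat \<Rightarrow> bool" where
  "property_c n A \<longleftrightarrow>
     (\<exists>s B. M_representation n A s B \<and> semiconvergent n (inverse s \<cdot>\<^sub>m B))"

definition splitting :: "nat \<Rightarrow> real mat \<Rightarrow> real mat \<Rightarrow> real mat \<Rightarrow> bool" where
  "splitting n A U V \<longleftrightarrow>
     U \<in> carrier_mat n n \<and> V \<in> carrier_mat n n \<and> A = U - V \<and> invertible_mat U"

definition regular_splitting :: "nat \<Rightarrow> real mat \<Rightarrow> real mat \<Rightarrow> real mat \<Rightarrow> bool" where
  "regular_splitting n A U V \<longleftrightarrow>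
     splitting n A U V \<and> 0\<^sub>m n n \<le> mat_inv U \<and> 0\<^sub>m n n \<le> V"

end

theory Submission
  imports Defs "Jordan_Normal_Form.Jordan_Normal_Form_Existence"
begin

text \<open>Write \<open>T\<close> for the iteration matrix. It equals \<open>I - G A\<close>, where
  \<open>G = X\<^sup>-\<^sup>1 (K + X - A + Y U\<^sup>-\<^sup>1 L) K\<^sup>-\<^sup>1\<close> is nonnegative and nonsingular, and
  \<open>T' = I - A G = Y X\<^sup>-\<^sup>1 V U\<^sup>-\<^sup>1 L K\<^sup>-\<^sup>1\<close>, which is similar to \<open>T\<close>, is nonnegative too.
  Scale so that \<open>A = I - W\<close> with \<open>W\<^sup>k\<close> converging to \<open>C\<close>, and let \<open>J\<close> be the set of zero columns
  of \<open>C\<close>. Both \<open>W\<close> and \<open>G\<close> map the span of the unit vectors in \<open>J\<close> into itself. There \<open>W\<^sup>k\<close> tends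
  to zero and \<open>T'\<close> contracts a positive functional, while on the quotient \<open>T'\<close> fixes the positive
  functional given by the column sums of \<open>C\<close>; hence the powers of \<open>T'\<close>, and so those of \<open>T\<close>, are
  bounded. If the diagonal of \<open>T\<close> is at least \<open>d > 0\<close>, boundedness confines the eigenvalues
  to the disc of radius \<open>1 - d\<close> about \<open>d\<close>, so \<open>1\<close> is the only one on the unit circle, and the Jordan form
  yields convergence.\<close>

section \<open>Nonnegative matrices and bounded sequences\<close>

text \<open>Formulated over any normed field, since it is applied to real matrices, to their
  complexifications and to Jordan matrices.\<close>

definition power_bounded :: "nat \<Rightarrow> 'a::real_normed_field mat \<Rightarrow> bool" where
  "power_bounded n M \<longleftrightarrow> (\<forall>i<n. \<forall>j<n. Bseq (\<lambda>k. (M ^\<^sub>m k) $$ (i,j)))"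

lemma mult_mat_entry:
  assumes "A \<in> carrier_mat n m" "B \<in> carrier_mat m l" "i < n" "j < l"
  shows "(A * B) $$ (i,j) = (\<Sum>k<m. A $$ (i,k) * B $$ (k,j))"
  using assms by (auto simp: scalar_prod_def lessThan_atLeast0 intro!: sum.cong)

lemma nonneg_mat_iff:
  fixes A :: "real mat"
  assumes "A \<in> carrier_mat n m"
  shows "0\<^sub>m n m \<le> A \<longleftrightarrow> (\<forall>i<n. \<forall>j<m. 0 \<le> A $$ (i,j))"
  using assms by (auto simp: less_eq_mat_def)

lemma nonneg_mat_mult:
  fixes A B :: "real mat"
  assumes A: "A \<in> carrier_mat n m" and B: "B \<in> carrier_mat m l" "0\<^sub>m n m \<le> A" "0\<^sub>m m l \<le> B"
  shows "0\<^sub>m n l \<le> A * B"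
proof -
  have "0 \<le> (A * B) $$ (i,j)" if "i < n" "j < l" for i j
    using assms that
    by (subst mult_mat_entry[OF A B(1) that]) (auto intro!: sum_nonneg simp: nonneg_mat_iff[OF A] nonneg_mat_iff[OF B(1)])
  then show ?thesis using nonneg_mat_iff[of "A * B" n l] A B by auto
qed

lemma nonneg_mat_add:
  fixes A B :: "real mat"
  assumes "A \<in> carrier_mat n m" "B \<in> carrier_mat n m" "0\<^sub>m n m \<le> A" "0\<^sub>m n m \<le> B"
  shows "0\<^sub>m n m \<le> A + B"
  using assms by (auto simp: less_eq_mat_def)

lemma nonneg_mat_pow:
  fixes A :: "real mat"
  assumes A: "A \<in> carrier_mat n n" and "0\<^sub>m n n \<le> A"
  shows "0\<^sub>m n n \<le> A ^\<^sub>m k"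
proof (induction k)
  case 0
  then show ?case using A by (auto simp: less_eq_mat_def)
next
  case (Suc k)
  then show ?case using nonneg_mat_mult[of "A ^\<^sub>m k" n n A n] assms by auto
qed

lemma Bseq_plus:
  fixes f g :: "nat \<Rightarrow> 'a::real_normed_vector"
  assumes "Bseq f" "Bseq g"
  shows "Bseq (\<lambda>k. f k + g k)"
proof -
  obtain b c where "\<And>k. norm (f k) \<le> b" "\<And>k. norm (g k) \<le> c"
    using assms by (auto elim!: BseqE)
  then have "norm (f k + g k) \<le> b + c" for k by (rule norm_triangle_mono)
  then show ?thesis by (rule BseqI')
qed

lemma Bseq_sum:
  fixes f :: "'b \<Rightarrow> nat \<Rightarrow> 'a::real_normed_vector"
  assumes "\<And>i. i \<in> A \<Longrightarrow> Bseq (f i)"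
  shows "Bseq (\<lambda>k. \<Sum>i\<in>A. f i k)"
  using assms by (induction A rule: infinite_finite_induct) (auto intro: Bseq_plus)

section \<open>Row vectors multiplied by matrices\<close>

text \<open>Row vectors are plain functions, so linear combinations and truncations carry no
  dimension conditions; only indices below \<open>n\<close> matter.\<close>

definition lmult :: "nat \<Rightarrow> (nat \<Rightarrow> real) \<Rightarrow> real mat \<Rightarrow> nat \<Rightarrow> real" where
  "lmult n u M j = (\<Sum>i<n. u i * M $$ (i,j))"

lemma lmult_mult:
  assumes A: "A \<in> carrier_mat n n" and B: "B \<in> carrier_mat n n" and j: "j < n"
  shows "lmult n u (A * B) j = lmult n (lmult n u A) B j"
proof -
  have "lmult n u (A * B) j = (\<Sum>i<n. \<Sum>k<n. u i * (A $$ (i,k) * B $$ (k,j)))"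
    unfolding lmult_def using j by (auto simp: mult_mat_entry[OF A B] sum_distrib_left intro!: sum.cong)
  also have "\<dots> = (\<Sum>k<n. \<Sum>i<n. u i * (A $$ (i,k) * B $$ (k,j)))" by (rule sum.swap)
  also have "\<dots> = lmult n (lmult n u A) B j"
    unfolding lmult_def by (auto simp: sum_distrib_right mult.assoc intro!: sum.cong)
  finally show ?thesis .
qed

lemma lmult_one: "j < n \<Longrightarrow> lmult n u (1\<^sub>m n) j = u j"
  unfolding lmult_def by (simp add: if_distrib cong: if_cong) 

lemma lmult_minus:
  assumes "A \<in> carrier_mat n n" "B \<in> carrier_mat n n" "j < n"
  shows "lmult n u (A - B) j = lmult n u A j - lmult n u B j"
  unfolding lmult_def using assms by (auto simp: right_diff_distrib sum_subtractf)

lemma lmult_mono: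
  assumes "A \<in> carrier_mat n n" "0\<^sub>m n n \<le> A" "j < n" "\<And>i. i < n \<Longrightarrow> u i \<le> v i"
  shows "lmult n u A j \<le> lmult n v A j"
  unfolding lmult_def using assms by (auto simp: nonneg_mat_iff intro!: sum_mono mult_right_mono)

lemma lmult_lin:
  "lmult n (\<lambda>i. a * u i + b * v i) A j = a * lmult n u A j + b * lmult n v A j"
  unfolding lmult_def by (simp add: sum.distrib sum_distrib_left algebra_simps)

lemma lmult_cong:
  "(\<And>i. i < n \<Longrightarrow> u i = v i) \<Longrightarrow> lmult n u A j = lmult n v A j"
  unfolding lmult_def by simp

lemma lmult_limit:
  assumes "\<And>i. i < n \<Longrightarrow> (\<lambda>k. (W k) $$ (i,j)) \<longlonglongrightarrow> C $$ (i,j)"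
  shows "(\<lambda>k. lmult n u (W k) j) \<longlonglongrightarrow> lmult n u C j"
  unfolding lmult_def using assms by (auto intro!: tendsto_intros)

lemma lmult_fixed_power:
  assumes A: "A \<in> carrier_mat n n" and fixed: "\<And>j. j < n \<Longrightarrow> lmult n u A j = u j" and "j < n"
  shows "lmult n u (A ^\<^sub>m k) j = u j"
  using \<open>j < n\<close>
proof (induction k arbitrary: j)
  case 0
  then show ?case using A by (simp add: lmult_one)
next
  case (Suc k)
  have "lmult n u (A ^\<^sub>m Suc k) j = lmult n (lmult n u (A ^\<^sub>m k)) A j"
    using lmult_mult[of "A ^\<^sub>m k" n A j u] A Suc.prems by simp
  also have "\<dots> = lmult n u A j" by (rule lmult_cong) (rule Suc.IH)
  finally show ?case using fixed Suc.prems by simp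
qed

section \<open>Power boundedness of \<open>1 - A G\<close>\<close>

lemma power_limit_nonneg:
  fixes W C :: "real mat"
  assumes W: "W \<in> carrier_mat n n" "0\<^sub>m n n \<le> W" and C: "C \<in> carrier_mat n n"
    and lim: "\<And>i j. i < n \<Longrightarrow> j < n \<Longrightarrow> (\<lambda>k. (W ^\<^sub>m k) $$ (i,j)) \<longlonglongrightarrow> C $$ (i,j)"
  shows "0\<^sub>m n n \<le> C"
  unfolding nonneg_mat_iff[OF C]
proof (intro allI impI)
  fix i j assume ij: "i < n" "j < n"
  have "0 \<le> (W ^\<^sub>m k) $$ (i,j)" for k
    using nonneg_mat_pow[OF W] nonneg_mat_iff[OF pow_carrier_mat[OF W(1)]] ij by blast
  then show "0 \<le> C $$ (i,j)" using LIMSEQ_le_const[OF lim[OF ij]] by blast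
qed

text \<open>Pass to the limit in \<open>W^(k+1) = W^k W\<close>. Hence the vector of column sums of
  \<open>C\<close> is a left fixed vector of \<open>W\<close>.\<close>

lemma power_limit_mult_right:
  fixes W C :: "real mat"
  assumes W: "W \<in> carrier_mat n n" and C: "C \<in> carrier_mat n n"
    and lim: "\<And>i j. i < n \<Longrightarrow> j < n \<Longrightarrow> (\<lambda>k. (W ^\<^sub>m k) $$ (i,j)) \<longlonglongrightarrow> C $$ (i,j)"
  shows "C * W = C"
proof (rule eq_matI)
  fix i j assume "i < dim_row C" "j < dim_col C"
  then have ij: "i < n" "j < n" using C by auto
  have "(\<lambda>k. (W ^\<^sub>m Suc k) $$ (i,j)) \<longlonglongrightarrow> C $$ (i,j)"
    using lim[OF ij] by (rule LIMSEQ_Suc)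
  moreover have "(\<lambda>k. (W ^\<^sub>m Suc k) $$ (i,j)) = (\<lambda>k. \<Sum>l<n. (W ^\<^sub>m k) $$ (i,l) * W $$ (l,j))"
    using mult_mat_entry[OF pow_carrier_mat[OF W] W ij] by simp
  moreover have "(\<lambda>k. \<Sum>l<n. (W ^\<^sub>m k) $$ (i,l) * W $$ (l,j)) \<longlonglongrightarrow> (\<Sum>l<n. C $$ (i,l) * W $$ (l,j))"
    using lim ij by (auto intro!: tendsto_intros)
  ultimately show "(C * W) $$ (i,j) = C $$ (i,j)"
    using LIMSEQ_unique mult_mat_entry[OF C W ij] by metis
qed (use C W in auto)

text \<open>Two nonnegative row vectors control \<open>R = 1 - A G\<close>: \<open>w\<close>,
  positive exactly off \<open>J\<close>, with \<open>w R = w\<close>, and \<open>u\<close>, positive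
  exactly on \<open>J\<close>, with \<open>u R \<le> \<theta> u + b w\<close> and
  \<open>\<theta> < 1\<close>. Their sum is positive and its images under the powers of the
  nonnegative \<open>R\<close> stay bounded, which bounds every entry.\<close>

lemma weak_regular_power_bounded:
  fixes W C G Gi :: "real mat"
  assumes W: "W \<in> carrier_mat n n" "0\<^sub>m n n \<le> W" and C: "C \<in> carrier_mat n n"
    and lim: "\<And>i j. i < n \<Longrightarrow> j < n \<Longrightarrow> (\<lambda>k. (W ^\<^sub>m k) $$ (i,j)) \<longlonglongrightarrow> C $$ (i,j)"
    and G: "G \<in> carrier_mat n n" "0\<^sub>m n n \<le> G"
    and Gi: "Gi \<in> carrier_mat n n" "Gi * G = 1\<^sub>m n"
    and T: "0\<^sub>m n n \<le> 1\<^sub>m n - G * (1\<^sub>m n - W)"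
    and T': "0\<^sub>m n n \<le> 1\<^sub>m n - (1\<^sub>m n - W) * G"
  shows "power_bounded n (1\<^sub>m n - (1\<^sub>m n - W) * G)"
proof -
  define A where "A = 1\<^sub>m n - W"
  define R where "R = 1\<^sub>m n - A * G"
  have Ac: "A \<in> carrier_mat n n" and Rc: "R \<in> carrier_mat n n"
    unfolding A_def R_def using W G by auto
  have Wk: "W ^\<^sub>m k \<in> carrier_mat n n" for k using W by simp
  have Rk: "R ^\<^sub>m k \<in> carrier_mat n n" for k using Rc by simp
  have R0: "0\<^sub>m n n \<le> R" using T' unfolding R_def A_def .
  have Rk0: "0 \<le> (R ^\<^sub>m k) $$ (i,j)" if "i < n" "j < n" for i j k
    using nonneg_mat_pow[OF Rc R0, of k] that unfolding nonneg_mat_iff[OF Rk] by blast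
  have W0: "0 \<le> W $$ (i,j)" if "i < n" "j < n" for i j
    using W(2) that unfolding nonneg_mat_iff[OF W(1)] by blast
  have Wk0: "0 \<le> (W ^\<^sub>m k) $$ (i,j)" if "i < n" "j < n" for i j k
    using nonneg_mat_pow[OF W, of k] that unfolding nonneg_mat_iff[OF Wk] by blast
  have G0: "0 \<le> G $$ (i,j)" if "i < n" "j < n" for i j
    using G(2) that unfolding nonneg_mat_iff[OF G(1)] by blast
  have C0: "0 \<le> C $$ (i,j)" if "i < n" "j < n" for i j
    using power_limit_nonneg[OF W C lim] that unfolding nonneg_mat_iff[OF C] by blast
  have lmultA: "lmult n u A j = u j - lmult n u W j" if "j < n" for u j
    unfolding A_def using lmult_minus[OF one_carrier_mat W(1) that] lmult_one[OF that] by simp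
  have lmultR: "lmult n u R j = u j - lmult n (lmult n u A) G j" if "j < n" for u j
    unfolding R_def using lmult_minus[OF one_carrier_mat _ that, of "A * G"] lmult_one[OF that]
      lmult_mult[OF Ac G(1) that] Ac G by simp

  define w where "w = lmult n (\<lambda>_. 1) C"
  define J where "J = {j. j < n \<and> w j = 0}"
  have finJ: "finite J" and Jn: "\<And>j. j \<in> J \<Longrightarrow> j < n" unfolding J_def by auto
  have w0: "0 \<le> w j" if "j < n" for j
    unfolding w_def lmult_def using C0 that by (auto intro!: sum_nonneg)
  have wW: "lmult n w W j = w j" if "j < n" for j
    using lmult_mult[OF C W(1) that, of "\<lambda>_. 1"] power_limit_mult_right[OF W(1) C lim] unfolding w_def by simp
  \<comment> \<open>From \<open>w W = w\<close> follows \<open>w A = 0\<close>, so the correction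
    \<open>(w A) G\<close> vanishes.\<close>
  have wR: "lmult n w R j = w j" if "j < n" for j
  proof -
    have "lmult n (lmult n w A) G j = lmult n (\<lambda>_. 0) G j"
      by (rule lmult_cong) (simp add: lmultA wW)
    then show ?thesis using lmultR[OF that] by (simp add: lmult_def)
  qed
  have CJ: "C $$ (i,j) = 0" if "j \<in> J" "i < n" for i j
  proof -
    have "(\<Sum>i<n. C $$ (i,j)) = 0" using that unfolding J_def w_def lmult_def by simp
    then show ?thesis using sum_nonneg_eq_0_iff[of "{..<n}" "\<lambda>i. C $$ (i,j)"] C0 that Jn by auto
  qed
  \<comment> \<open>At \<open>j\<close> in \<open>J\<close> the identity \<open>w W = w\<close> is a
    vanishing sum of nonnegative terms, and \<open>w i\<close> is nonzero off
    \<open>J\<close>.\<close>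
  have WJ: "W $$ (i,j) = 0" if "j \<in> J" "i < n" "i \<notin> J" for i j
  proof -
    have "(\<Sum>i<n. w i * W $$ (i,j)) = 0"
      using wW[of j] that(1) unfolding J_def lmult_def by simp
    then have "w i * W $$ (i,j) = 0"
      using sum_nonneg_eq_0_iff[of "{..<n}" "\<lambda>i. w i * W $$ (i,j)"] w0 W0 that Jn by auto
    then show ?thesis using that unfolding J_def by auto
  qed
  text \<open>Off the diagonal \<open>G A \<le> 0\<close>, so on \<open>J\<close> a row \<open>g\<close> of \<open>G\<close> with index outside \<open>J\<close> satisfies
    \<open>g \<le> g W \<le> g W\<^sup>2 \<le> \<dots>\<close>, which tends to \<open>g C = 0\<close> there.\<close>
  have GJ: "G $$ (i,j) = 0" if j: "j \<in> J" and i: "i < n" "i \<notin> J" for i j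
  proof -
    define g where "g l = G $$ (i,l)" for l
    have le: "g l \<le> lmult n g W l" if l: "l \<in> J" for l
    proof -
      have ln: "l < n" and il: "i \<noteq> l" using Jn l i by auto
      have "(G * A) $$ (i,l) = lmult n g A l"
        unfolding lmult_def g_def using mult_mat_entry[OF G(1) Ac i(1) ln] .
      moreover have "0 \<le> (1\<^sub>m n - G * A) $$ (i,l)"
        using T nonneg_mat_iff[OF minus_carrier_mat[OF mult_carrier_mat[OF G(1) Ac]], of "1\<^sub>m n"] i ln
      unfolding A_def by auto
      then have "(G * A) $$ (i,l) \<le> 0" using i ln il G Ac by simp
      ultimately show ?thesis using lmultA[OF ln] by simp
    qed
    have "g l \<le> lmult n g (W ^\<^sub>m k) l" if "l \<in> J" for l k
      using that
    proof (induction k arbitrary: l)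
      case 0
      then show ?case using W Jn by (simp add: lmult_one)
    next
      case (Suc k)
      \<comment> \<open>Rows outside \<open>J\<close> contribute nothing by \<open>WJ\<close>, so
        the induction hypothesis on \<open>J\<close> suffices.\<close>
      have "lmult n g W l \<le> lmult n (lmult n g (W ^\<^sub>m k)) W l"
        unfolding lmult_def[of n _ W]
      proof (rule sum_mono)
        fix i assume "i \<in> {..<n}"
        then show "g i * W $$ (i,l) \<le> lmult n g (W ^\<^sub>m k) i * W $$ (i,l)"
          using Suc.IH[of i] WJ[OF Suc.prems, of i] W0[of i l] Jn Suc.prems
          by (cases "i \<in> J") (auto intro: mult_right_mono)
      qed
      then show ?case
        using le[OF Suc.prems] lmult_mult[OF Wk[of k] W(1) Jn[OF Suc.prems], of g] by simp
    qed
    moreover have "(\<lambda>k. lmult n g (W ^\<^sub>m k) j) \<longlonglongrightarrow> lmult n g C j"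
      using lim Jn[OF j] by (intro lmult_limit) auto
    ultimately have "g j \<le> lmult n g C j" using j LIMSEQ_le_const by blast
    also have "\<dots> = 0" unfolding lmult_def using CJ j by simp
    finally show ?thesis using G0[OF i(1) Jn[OF j]] unfolding g_def by simp
  qed

  \<comment> \<open>On \<open>J\<close> the column sums of \<open>W^m\<close> tend to
    \<open>w j = 0\<close>; as \<open>J\<close> is finite, one threshold serves all of it.\<close>
  have "\<forall>\<^sub>F m in sequentially. \<forall>j\<in>J. lmult n (\<lambda>_. 1) (W ^\<^sub>m m) j < 1/2"
  proof (rule eventually_ball_finite[OF finJ], rule ballI)
    fix j assume j: "j \<in> J"
    have "(\<lambda>k. lmult n (\<lambda>_. 1) (W ^\<^sub>m k) j) \<longlonglongrightarrow> w j"
      unfolding w_def using lim Jn[OF j] by (intro lmult_limit) auto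
    moreover have "w j < 1/2" using j unfolding J_def by simp
    ultimately show "\<forall>\<^sub>F m in sequentially. lmult n (\<lambda>_. 1) (W ^\<^sub>m m) j < 1/2"
      by (rule order_tendstoD)
  qed
  then obtain m0 where m0: "\<And>m j. m0 \<le> m \<Longrightarrow> j \<in> J \<Longrightarrow> lmult n (\<lambda>_. 1) (W ^\<^sub>m m) j < 1/2"
    unfolding eventually_sequentially by blast
  \<comment> \<open>The successor makes \<open>m\<close> positive, so that the sum in
    \<open>u\<close> contains the term \<open>r = 0\<close>, which is 1.\<close>
  define m where "m = Suc m0"
  \<comment> \<open>A truncated Neumann series applied to the all-ones row. On \<open>J\<close>,
    multiplication by \<open>A = 1 - W\<close> telescopes it to one minus the column sum of
    \<open>W^m\<close>, which exceeds 1/2.\<close>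
  define u where "u j = (if j \<in> J then \<Sum>r<m. lmult n (\<lambda>_. 1) (W ^\<^sub>m r) j else 0)" for j
  have Wr0: "0 \<le> lmult n (\<lambda>_. 1) (W ^\<^sub>m r) j" if "j < n" for r j
    unfolding lmult_def using Wk0 that by (auto intro!: sum_nonneg)
  have u1: "1 \<le> u j" if "j \<in> J" for j
  proof -
    have "lmult n (\<lambda>_. 1) (W ^\<^sub>m 0) j \<le> (\<Sum>r<m. lmult n (\<lambda>_. 1) (W ^\<^sub>m r) j)"
      using Wr0 Jn[OF that] by (intro member_le_sum) (auto simp: m_def)
    then show ?thesis using that W Jn[OF that] unfolding u_def by (simp add: lmult_one)
  qed
  have u0: "0 \<le> u j" for j using u1[of j] by (cases "j \<in> J") (auto simp: u_def)
  have uA: "1/2 \<le> lmult n u A j" if j: "j \<in> J" for j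
  proof -
    \<comment> \<open>By \<open>WJ\<close>, cutting \<open>u\<close> to zero outside
      \<open>J\<close> does not affect its product with a column in \<open>J\<close>.\<close>
    have "lmult n u W j = (\<Sum>i<n. (\<Sum>r<m. lmult n (\<lambda>_. 1) (W ^\<^sub>m r) i) * W $$ (i,j))"
      unfolding lmult_def[of n u] u_def using WJ[OF j] by (auto intro!: sum.cong)
    also have "\<dots> = (\<Sum>r<m. lmult n (lmult n (\<lambda>_. 1) (W ^\<^sub>m r)) W j)"
      unfolding lmult_def[of n _ W] sum_distrib_right by (rule sum.swap)
    also have "\<dots> = (\<Sum>r<m. lmult n (\<lambda>_. 1) (W ^\<^sub>m Suc r) j)"
      using lmult_mult[OF Wk W(1) Jn[OF j], of "\<lambda>_. 1"] by simp
    finally have "lmult n u A j = (\<Sum>r<m. lmult n (\<lambda>_. 1) (W ^\<^sub>m r) j - lmult n (\<lambda>_. 1) (W ^\<^sub>m Suc r) j)"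
      using lmultA[OF Jn[OF j]] j by (simp only: u_def sum_subtractf if_True)
    also have "\<dots> = lmult n (\<lambda>_. 1) (W ^\<^sub>m 0) j - lmult n (\<lambda>_. 1) (W ^\<^sub>m m) j"
      by (rule sum_lessThan_telescope')
    finally show ?thesis using m0[of m j] j Jn[OF j] W by (simp add: m_def lmult_one)
  qed
  \<comment> \<open>The loss \<open>u - u R\<close> is \<open>(u A) G\<close>. In column
    \<open>j\<close> only rows in \<open>J\<close> contribute, by \<open>GJ\<close>; there
    \<open>u A\<close> is at least 1/2, and the column is nonzero because \<open>G\<close> has a
    left inverse.\<close>
  have uR: "lmult n u R j < u j" if j: "j \<in> J" for j
  proof -
    have jn: "j < n" using Jn j by blast
    have nn: "0 \<le> lmult n u A i * G $$ (i,j)" if "i < n" for i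
      using uA[of i] GJ[OF j that] G0[OF that jn] by (cases "i \<in> J") auto
    have "(\<Sum>k<n. Gi $$ (j,k) * G $$ (k,j)) = 1"
      using mult_mat_entry[OF Gi(1) G(1) jn jn] Gi(2) jn by simp
    then obtain i where i: "i < n" "G $$ (i,j) \<noteq> 0"
      by (metis (no_types, lifting) lessThan_iff mult_zero_right sum.neutral zero_neq_one)
    have "i \<in> J" using i GJ[OF j] by blast
    then have "0 < lmult n u A i * G $$ (i,j)"
      using uA[of i] G0[OF i(1) jn] i(2) by (intro mult_pos_pos) auto
    then have "0 < lmult n (lmult n u A) G j"
      unfolding lmult_def[of n _ G] using nn i(1) by (intro sum_pos2[of _ i]) auto
    then show ?thesis using lmultR[OF jn] by simp
  qed

  have upos: "0 < u j" if "j \<in> J" for j using u1[OF that] by simp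
  \<comment> \<open>Finitely many ratios below 1 have a maximum below 1; the inserted 0 covers an
    empty \<open>J\<close> and keeps \<theta> nonnegative.\<close>
  define \<theta> where "\<theta> = Max (insert 0 ((\<lambda>j. lmult n u R j / u j) ` J))"
  have \<theta>: "0 \<le> \<theta>" "\<theta> < 1"
    unfolding \<theta>_def using finJ uR upos by auto
  have \<theta>u: "lmult n u R j \<le> \<theta> * u j" if "j \<in> J" for j
  proof -
    have "lmult n u R j / u j \<le> \<theta>" unfolding \<theta>_def using finJ that by auto
    then show ?thesis using u1[OF that] by (simp add: divide_le_eq)
  qed
  \<comment> \<open>Off \<open>J\<close> the vector \<open>w\<close> is positive, so whatever
    \<open>u R\<close> has there is charged to \<open>w\<close> at the rate
    \<open>b\<close>.\<close>
  define b where "b = Max (insert 0 ((\<lambda>j. lmult n u R j / w j) ` ({..<n} - J)))"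
  have b: "lmult n u R j \<le> b * w j" if "j < n" "j \<notin> J" for j
  proof -
    have "lmult n u R j / w j \<le> b" unfolding b_def using that by auto
    moreover have "0 < w j" using w0[of j] that unfolding J_def by auto
    ultimately show ?thesis by (simp add: divide_le_eq)
  qed
  have step: "lmult n u R j \<le> \<theta> * u j + b * w j" if "j < n" for j
    using \<theta>u[of j] b[OF that] by (cases "j \<in> J") (auto simp: J_def u_def)
  \<comment> \<open>The sum of the geometric series with first term \<open>b\<close> and ratio
    \<theta>; its partial sums are the coefficients of \<open>w\<close> in
    \<open>pow\<close>.\<close>
  define \<beta> where "\<beta> = b / (1 - \<theta>)"
  have b\<beta>: "b = \<beta> * (1 - \<theta>)" unfolding \<beta>_def using \<theta> by simp
  have \<beta>0: "0 \<le> \<beta>" unfolding \<beta>_def b_def using \<theta> by (auto intro!: divide_nonneg_nonneg)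
  have pow: "lmult n u (R ^\<^sub>m k) j \<le> \<theta> ^ k * u j + \<beta> * (1 - \<theta> ^ k) * w j" if "j < n" for k j
    using that
  proof (induction k arbitrary: j)
    case 0
    then show ?case using Rc by (simp add: lmult_one)
  next
    case (Suc k)
    have "lmult n u (R ^\<^sub>m Suc k) j = lmult n (lmult n u (R ^\<^sub>m k)) R j"
      using lmult_mult[OF Rk Rc Suc.prems] by simp
    also have "\<dots> \<le> lmult n (\<lambda>j. \<theta> ^ k * u j + \<beta> * (1 - \<theta> ^ k) * w j) R j"
      using Suc by (intro lmult_mono[OF Rc R0]) auto
    also have "\<dots> = \<theta> ^ k * lmult n u R j + \<beta> * (1 - \<theta> ^ k) * w j"
      unfolding lmult_lin wR[OF Suc.prems] ..
    also have "\<dots> \<le> \<theta> ^ k * (\<theta> * u j + b * w j) + \<beta> * (1 - \<theta> ^ k) * w j"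
      using step[OF Suc.prems] \<theta> by (intro add_right_mono mult_left_mono) auto
    also have "\<dots> = \<theta> ^ Suc k * u j + \<beta> * (1 - \<theta> ^ Suc k) * w j"
      unfolding b\<beta> by (simp add: algebra_simps)
    finally show ?case .
  qed
  \<comment> \<open>The factors 1 make \<open>h\<close> an instance of
    \<open>lmult_lin\<close>.\<close>
  define h where "h i = 1 * u i + 1 * w i" for i
  have h: "0 < h i" if "i < n" for i
    using u0[of i] w0[OF that] u1[of i] that unfolding h_def J_def by (cases "i \<in> J") (auto simp: J_def)
  have "power_bounded n R"
    unfolding power_bounded_def
  proof (intro allI impI)
    fix i j assume ij: "i < n" "j < n"
    show "Bseq (\<lambda>k. (R ^\<^sub>m k) $$ (i,j))"
    proof (rule BseqI')
      fix k
      have "h i * (R ^\<^sub>m k) $$ (i,j) \<le> lmult n h (R ^\<^sub>m k) j"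
        unfolding lmult_def using ij Rk0 h by (intro member_le_sum) (auto simp: less_imp_le)
      also have "\<dots> = lmult n u (R ^\<^sub>m k) j + lmult n w (R ^\<^sub>m k) j"
        unfolding h_def lmult_lin by simp
      also have "\<dots> \<le> \<theta> ^ k * u j + \<beta> * (1 - \<theta> ^ k) * w j + w j"
        using pow[OF ij(2)] lmult_fixed_power[OF Rc wR ij(2)] by simp
      also have "\<dots> \<le> 1 * u j + \<beta> * 1 * w j + w j"
        using \<theta> \<beta>0 w0[OF ij(2)] u0[of j]
        by (intro add_mono mult_right_mono mult_left_mono) (auto simp: power_le_one)
      finally show "norm ((R ^\<^sub>m k) $$ (i,j)) \<le> (u j + \<beta> * w j + w j) / h i"
        using h[OF ij(1)] Rk0[OF ij] by (simp add: field_simps)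
    qed
  qed
  then show ?thesis unfolding R_def A_def .
qed

section \<open>Similarity, Jordan form and convergence of powers\<close>

text \<open>The coefficients do not depend on \<open>k\<close>, so boundedness and convergence of
  the powers both pass through a similarity.\<close>

lemma similar_power_entry:
  assumes wit: "similar_mat_wit A B P Q" and B: "B \<in> carrier_mat n n" and ij: "i < n" "j < n"
  shows "(A ^\<^sub>m k) $$ (i,j) = (\<Sum>l<n. (\<Sum>m<n. P $$ (i,m) * (B ^\<^sub>m k) $$ (m,l)) * Q $$ (l,j))"
proof -
  have P: "P \<in> carrier_mat n n" and Q: "Q \<in> carrier_mat n n"
    using similar_mat_witD(6,7)[OF refl wit] similar_mat_witD(5)[OF refl wit] carrier_matD(1)[OF B]
    by (metis carrier_matD(1))+
  note Bk = pow_carrier_mat[OF B, of k]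
  have "(A ^\<^sub>m k) $$ (i,j) = (P * B ^\<^sub>m k * Q) $$ (i,j)"
    by (subst similar_mat_wit_pow_id[OF wit]) (rule refl)
  also have "\<dots> = (\<Sum>l<n. (P * B ^\<^sub>m k) $$ (i,l) * Q $$ (l,j))"
    by (rule mult_mat_entry[OF mult_carrier_mat[OF P Bk] Q ij])
  also have "\<dots> = (\<Sum>l<n. (\<Sum>m<n. P $$ (i,m) * (B ^\<^sub>m k) $$ (m,l)) * Q $$ (l,j))"
    by (rule sum.cong[OF refl]) (simp only: lessThan_iff mult_mat_entry[OF P Bk ij(1)])
  finally show ?thesis .
qed

lemma power_bounded_similar:
  assumes wit: "similar_mat_wit A B P Q" and B: "B \<in> carrier_mat n n" and bounded: "power_bounded n B"
  shows "power_bounded n A"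
  unfolding power_bounded_def
proof (intro allI impI)
  fix i j assume ij: "i < n" "j < n"
  have "Bseq (\<lambda>k. (B ^\<^sub>m k) $$ (m,l))" if "m \<in> {..<n}" "l \<in> {..<n}" for m l
    using bounded that unfolding power_bounded_def by blast
  then show "Bseq (\<lambda>k. (A ^\<^sub>m k) $$ (i,j))"
    by (subst similar_power_entry[OF wit B ij]) (rule Bseq_sum, rule Bseq_mult[OF _ Bfun_const], rule Bseq_sum, rule Bseq_mult[OF Bfun_const])
qed

lemma powers_convergent_similar:
  fixes A B :: "'a::real_normed_field mat"
  assumes wit: "similar_mat_wit A B P Q" and B: "B \<in> carrier_mat n n"
    and conv: "\<And>i j. i < n \<Longrightarrow> j < n \<Longrightarrow> convergent (\<lambda>k. (B ^\<^sub>m k) $$ (i,j))"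
    and ij: "i < n" "j < n"
  shows "convergent (\<lambda>k. (A ^\<^sub>m k) $$ (i,j))"
proof -
  have "convergent (\<lambda>k. (B ^\<^sub>m k) $$ (m,l))" if "m \<in> {..<n}" "l \<in> {..<n}" for m l
    using conv that by blast
  then show ?thesis
    by (subst similar_power_entry[OF wit B ij])
      (rule convergent_sum, rule convergent_mult[OF _ convergent_const], rule convergent_sum, rule convergent_mult[OF convergent_const])
qed

text \<open>For \<open>a = 1\<close> the entry at (0,1) of the \<open>k\<close>-th power is
  \<open>k\<close>, so boundedness forces size 1. For \<open>norm a < 1\<close> the powers are
  compared with those of a block with a larger real value below 1.\<close>

lemma jordan_block_powers_convergent:
  fixes a :: "'a::real_normed_field"
  assumes bounded: "power_bounded m (jordan_block m a)" and a: "norm a < 1 \<or> a = 1"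
    and ij: "i < m" "j < m"
  shows "convergent (\<lambda>k. (jordan_block m a ^\<^sub>m k) $$ (i,j))"
proof (cases "a = 1")
  case True
  have "m = 1"
  proof (rule ccontr)
    assume "m \<noteq> 1"
    then have m: "0 < m" "1 < m" using ij by auto
    have "Bseq (\<lambda>k. (jordan_block m a ^\<^sub>m k) $$ (0,1))"
      using bounded m unfolding power_bounded_def by blast
    moreover have "(jordan_block m a ^\<^sub>m k) $$ (0,1) = of_nat k" for k
      unfolding jordan_block_pow True using m by simp
    ultimately have "Bseq (\<lambda>k. of_nat k :: 'a)" by simp
    then obtain c where c: "\<And>k. norm (of_nat k :: 'a) \<le> c" unfolding Bseq_def by blast
    obtain k where "c < real k" using reals_Archimedean2 by blast
    then show False using c[of k] by simp
  qed
  then show ?thesis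
    using ij True unfolding jordan_block_pow by (simp add: convergent_const)
next
  case False
  then have a1: "norm a < 1" using a by blast
  \<comment> \<open>Any value strictly between \<open>norm a\<close> and 1 would serve: the powers
    for \<open>b\<close> stay bounded, and passing from \<open>b\<close> to \<open>a\<close> leaves
    a decaying geometric factor.\<close>
  define b where "b = (1 + norm a) / 2"
  have b: "0 < b" "norm a < b" "b < 1" unfolding b_def using a1 by (auto simp: add_pos_nonneg)
  then have "norm b < 1" by simp
  from jordan_block_constant_bound[OF this, of m]
  obtain p where "\<forall>i j k. i < m \<longrightarrow> j < m \<longrightarrow> norm ((jordan_block m b ^\<^sub>m k) $$ (i,j)) \<le> p" ..
  then have p: "norm ((jordan_block m b ^\<^sub>m k) $$ (i,j)) \<le> p" for k using ij by simp
  \<comment> \<open>The subtraction is truncated when \<open>k + i < j\<close>, but then both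
    entries are zero through their binomial coefficient.\<close>
  have bound: "norm ((jordan_block m a ^\<^sub>m k) $$ (i,j)) \<le> p * (norm a / b) ^ (k + i - j)" for k
  proof -
    have "norm ((jordan_block m a ^\<^sub>m k) $$ (i,j)) =
      norm ((jordan_block m b ^\<^sub>m k) $$ (i,j)) * (norm a / b) ^ (k + i - j)"
      unfolding jordan_block_pow using ij b by (simp add: norm_mult norm_power power_divide)
    also have "\<dots> \<le> p * (norm a / b) ^ (k + i - j)"
      using p b by (intro mult_right_mono) auto
    finally show ?thesis .
  qed
  have r: "norm (norm a / b) < 1" using b by simp
  have "(\<lambda>k. (norm a / b) ^ (k + i)) \<longlonglongrightarrow> 0"
    using LIMSEQ_power_zero[OF r] by (rule LIMSEQ_ignore_initial_segment)
  \<comment> \<open>Delaying the sequence by \<open>j\<close> removes the truncated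
    subtraction.\<close>
  moreover have shift: "k + j + i - j = k + i" for k by simp
  ultimately have "(\<lambda>k. (norm a / b) ^ (k + j + i - j)) \<longlonglongrightarrow> 0" by (simp only: shift)
  then have "(\<lambda>k. (norm a / b) ^ (k + i - j)) \<longlonglongrightarrow> 0"
    by (rule LIMSEQ_offset[where f = "\<lambda>k. (norm a / b) ^ (k + i - j)"])
  then have lim: "(\<lambda>k. p * (norm a / b) ^ (k + i - j)) \<longlonglongrightarrow> 0"
    by (rule tendsto_mult_right_zero)
  have "(\<lambda>k. norm ((jordan_block m a ^\<^sub>m k) $$ (i,j))) \<longlonglongrightarrow> 0"
  proof (rule tendsto_sandwich)
    show "\<forall>\<^sub>F k in sequentially. 0 \<le> norm ((jordan_block m a ^\<^sub>m k) $$ (i,j))" by (rule always_eventually) simp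
    show "\<forall>\<^sub>F k in sequentially. norm ((jordan_block m a ^\<^sub>m k) $$ (i,j)) \<le> p * (norm a / b) ^ (k + i - j)"
      by (rule always_eventually) (rule allI, rule bound)
  qed (rule tendsto_const, rule lim)
  then have "(\<lambda>k. (jordan_block m a ^\<^sub>m k) $$ (i,j)) \<longlonglongrightarrow> 0"
    by (rule tendsto_norm_zero_cancel)
  then show ?thesis by (rule convergentI)
qed

text \<open>Powers of a block diagonal matrix are block diagonal, so the first block and the
  remaining Jordan matrix inherit boundedness, and the entries outside them are constantly
  zero.\<close>

lemma jordan_matrix_powers_convergent:
  fixes n_as :: "(nat \<times> 'a::real_normed_field) list"
  assumes "power_bounded (sum_list (map fst n_as)) (jordan_matrix n_as)"
    and "\<And>m a. (m,a) \<in> set n_as \<Longrightarrow> norm a < 1 \<or> a = 1"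
    and "i < sum_list (map fst n_as)" "j < sum_list (map fst n_as)"
  shows "convergent (\<lambda>k. (jordan_matrix n_as ^\<^sub>m k) $$ (i,j))"
  using assms
proof (induction n_as arbitrary: i j)
  case Nil
  then show ?case by simp
next
  case (Cons na n_as)
  obtain m a where na: "na = (m,a)" by force
  define s where "s = sum_list (map fst n_as)"
  have dims: "dim_row (jordan_matrix n_as ^\<^sub>m k) = s" "dim_col (jordan_matrix n_as ^\<^sub>m k) = s" for k
    unfolding s_def using pow_carrier_mat[OF jordan_matrix_carrier[of n_as]] by auto
  have pow: "jordan_matrix (na # n_as) ^\<^sub>m k = four_block_mat (jordan_block m a ^\<^sub>m k) (0\<^sub>m m s) (0\<^sub>m s m) (jordan_matrix n_as ^\<^sub>m k)" for k
  proof -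
    have "diag_block_mat (map (\<lambda>(n, a). jordan_block n a ^\<^sub>m k) n_as) = jordan_matrix n_as ^\<^sub>m k"
      by (rule jordan_matrix_pow[symmetric])
    then show ?thesis unfolding na jordan_matrix_pow[of "(m,a) # n_as"] by (simp add: Let_def dims del: pow_mat_dim)
  qed
  have entry: "(jordan_matrix (na # n_as) ^\<^sub>m k) $$ (i,j) =
      (if i < m then if j < m then (jordan_block m a ^\<^sub>m k) $$ (i,j) else 0
       else if j < m then 0 else (jordan_matrix n_as ^\<^sub>m k) $$ (i - m, j - m))"
    if "i < m + s" "j < m + s" for i j k
    unfolding pow using that by (subst index_mat_four_block(1)) (simp_all add: dims del: pow_mat_dim)
  have bounded: "Bseq (\<lambda>k. (jordan_matrix (na # n_as) ^\<^sub>m k) $$ (i,j))" if "i < m + s" "j < m + s" for i j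
    using Cons.prems(1) that unfolding power_bounded_def na s_def by simp
  have block: "power_bounded m (jordan_block m a)"
    unfolding power_bounded_def
  proof (intro allI impI)
    fix i j assume "i < m" "j < m"
    then show "Bseq (\<lambda>k. (jordan_block m a ^\<^sub>m k) $$ (i,j))" using bounded[of i j] by (simp add: entry)
  qed
  have rest: "power_bounded s (jordan_matrix n_as)"
    unfolding power_bounded_def
  proof (intro allI impI)
    fix i j assume "i < s" "j < s"
    then show "Bseq (\<lambda>k. (jordan_matrix n_as ^\<^sub>m k) $$ (i,j))" using bounded[of "m + i" "m + j"] by (simp add: entry)
  qed
  have ij: "i < m + s" "j < m + s" using Cons.prems(3,4) unfolding na s_def by auto
  have "norm a < 1 \<or> a = 1" using Cons.prems(2)[of m a] na by simp
  then have 1: "convergent (\<lambda>k. (jordan_block m a ^\<^sub>m k) $$ (i,j))" if "i < m" "j < m"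
    using jordan_block_powers_convergent[OF block] that by blast
  have 2: "convergent (\<lambda>k. (jordan_matrix n_as ^\<^sub>m k) $$ (i - m, j - m))" if "\<not> i < m" "\<not> j < m"
    using ij that Cons.prems(2) rest unfolding s_def by (intro Cons.IH) auto
  show ?case unfolding entry[OF ij] using 1 2 convergent_const[of 0]
    by (cases "i < m"; cases "j < m") simp_all
qed

text \<open>Over the complex numbers a Jordan form exists and inherits boundedness, and the value of
  each block is an eigenvalue, hence subject to \<open>spec\<close>.\<close>

lemma powers_convergent_of_spectrum:
  fixes M :: "complex mat"
  assumes M: "M \<in> carrier_mat n n" and bounded: "power_bounded n M"
    and spec: "\<And>a. eigenvalue M a \<Longrightarrow> norm a < 1 \<or> a = 1"
    and ij: "i < n" "j < n"
  shows "convergent (\<lambda>k. (M ^\<^sub>m k) $$ (i,j))"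
proof -
  obtain as where "char_poly M = (\<Prod>a\<leftarrow>as. [:- a, 1:])"
    using char_poly_factorized[OF M] by blast
  then obtain n_as where jnf: "jordan_nf M n_as" using jordan_nf_exists[OF M] by blast
  then obtain P Q where wit: "similar_mat_wit M (jordan_matrix n_as) P Q"
    unfolding jordan_nf_def similar_mat_def by blast
  have J: "jordan_matrix n_as \<in> carrier_mat n n"
    using wit M unfolding similar_mat_wit_def Let_def by auto
  then have n: "sum_list (map fst n_as) = n" by auto
  have "norm a < 1 \<or> a = 1" if "(m,a) \<in> set n_as" for m a
  proof -
    \<comment> \<open>A block of size zero would contribute no root to the characteristic
      polynomial; \<open>jordan_nf\<close> excludes it.\<close>
    have "m \<noteq> 0" using jnf that unfolding jordan_nf_def by force
    moreover from split_list[OF that] obtain xs ys where "n_as = xs @ (m,a) # ys" by blast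
    ultimately have "poly (char_poly M) a = 0"
      unfolding jordan_nf_char_poly[OF jnf] by (simp add: poly_power)
    then show ?thesis using spec eigenvalue_root_char_poly[OF M] by blast
  qed
  moreover have "power_bounded n (jordan_matrix n_as)"
    using power_bounded_similar[OF similar_mat_wit_sym[OF wit] M bounded] .
  ultimately have "convergent (\<lambda>k. (jordan_matrix n_as ^\<^sub>m k) $$ (i,j))" if "i < n" "j < n" for i j
    using that by (intro jordan_matrix_powers_convergent) (auto simp: n)
  then show ?thesis by (rule powers_convergent_similar[OF wit J _ ij])
qed

section \<open>Eigenvalues and the positive diagonal\<close>

text \<open>For an eigenvector \<open>x\<close>, the vector \<open>\<bar>x\<bar>\<close> grows under \<open>M\<close> by at least the factor
  \<open>d + \<bar>a - d\<bar>\<close>.\<close>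
lemma nonneg_power_bounded_eigenvalue:
  fixes M :: "real mat"
  assumes M: "M \<in> carrier_mat n n" "0\<^sub>m n n \<le> M" and bounded: "power_bounded n M"
    and d: "\<And>i. i < n \<Longrightarrow> d \<le> M $$ (i,i)" "0 \<le> d"
    and ev: "eigenvalue (map_mat complex_of_real M) a"
  shows "norm (a - d) \<le> 1 - d"
proof -
  obtain x where x: "x \<in> carrier_vec n" "x \<noteq> 0\<^sub>v n" "map_mat complex_of_real M *\<^sub>v x = a \<cdot>\<^sub>v x"
    using ev M unfolding eigenvalue_def eigenvector_def by auto
  define f where "f i = norm (x $ i)" for i
  define c where "c = d + norm (a - d)"
  have c0: "0 \<le> c" unfolding c_def using d by simp
  have M0: "0 \<le> M $$ (i,j)" if "i < n" "j < n" for i j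
    using M(2) that unfolding nonneg_mat_iff[OF M(1)] by blast
  have Mk: "M ^\<^sub>m k \<in> carrier_mat n n" for k using M by simp
  have Mk0: "0 \<le> (M ^\<^sub>m k) $$ (i,j)" if "i < n" "j < n" for i j k
    using nonneg_mat_pow[OF M, of k] that unfolding nonneg_mat_iff[OF Mk] by blast
  have step: "c * f i \<le> (\<Sum>j<n. M $$ (i,j) * f j)" if i: "i < n" for i
  proof -
    \<comment> \<open>Removing \<open>d\<close> times the identity leaves a nonnegative matrix, so
      the triangle inequality applies to \<open>(a - d) x = N x\<close> and measures the distance of
      \<open>a\<close> from \<open>d\<close> instead of from 0.\<close>
    define N where "N j = M $$ (i,j) - (if j = i then d else 0)" for j
    have N0: "0 \<le> N j" if "j < n" for j
      unfolding N_def using M0[OF i that] d(1)[OF i] by auto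
    have "(\<Sum>j<n. complex_of_real (M $$ (i,j)) * x $ j) = (map_mat complex_of_real M *\<^sub>v x) $ i"
      using i x(1) M(1) by (auto simp: scalar_prod_def lessThan_atLeast0 intro!: sum.cong)
    then have "a * x $ i = (\<Sum>j<n. complex_of_real (M $$ (i,j)) * x $ j)"
      unfolding x(3) using i x by simp
    also have "\<dots> = (\<Sum>j<n. complex_of_real (N j) * x $ j) + d * x $ i"
      using i unfolding N_def
      by (simp add: left_diff_distrib sum_subtractf if_distrib[of complex_of_real] if_distrib[of "\<lambda>t. t * _"] cong: if_cong)
    finally have "(a - d) * x $ i = (\<Sum>j<n. complex_of_real (N j) * x $ j)"
      by (simp add: left_diff_distrib)
    then have "norm (a - d) * f i \<le> (\<Sum>j<n. norm (complex_of_real (N j) * x $ j))"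
      unfolding f_def using norm_sum norm_mult by metis
    also have "\<dots> = (\<Sum>j<n. N j * f j)" unfolding f_def using N0 by (simp add: norm_mult)
    also have "\<dots> = (\<Sum>j<n. M $$ (i,j) * f j) - d * f i"
      using i unfolding N_def by (simp add: left_diff_distrib sum_subtractf if_distrib[of "\<lambda>t. t * _"] cong: if_cong)
    finally show ?thesis unfolding c_def by (simp add: algebra_simps)
  qed
  have pow: "c ^ k * f i \<le> (\<Sum>j<n. (M ^\<^sub>m k) $$ (i,j) * f j)" if i: "i < n" for i k
  proof (induction k)
    case 0
    then show ?case using i M by (simp add: if_distrib[of "\<lambda>t. t * _"] cong: if_cong)
  next
    case (Suc k)
    have "c ^ Suc k * f i \<le> c * (\<Sum>j<n. (M ^\<^sub>m k) $$ (i,j) * f j)"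
      using mult_left_mono[OF Suc c0] by (simp add: mult.assoc)
    also have "\<dots> = (\<Sum>j<n. (M ^\<^sub>m k) $$ (i,j) * (c * f j))"
      by (simp add: sum_distrib_left mult.left_commute)
    also have "\<dots> \<le> (\<Sum>j<n. (M ^\<^sub>m k) $$ (i,j) * (\<Sum>l<n. M $$ (j,l) * f l))"
      using step Mk0 i by (intro sum_mono mult_left_mono) auto
    also have "\<dots> = (\<Sum>j<n. \<Sum>l<n. (M ^\<^sub>m k) $$ (i,j) * M $$ (j,l) * f l)"
      by (simp add: sum_distrib_left mult.assoc)
    also have "\<dots> = (\<Sum>l<n. \<Sum>j<n. (M ^\<^sub>m k) $$ (i,j) * M $$ (j,l) * f l)"
      by (rule sum.swap)
    also have "\<dots> = (\<Sum>l<n. (M ^\<^sub>m Suc k) $$ (i,l) * f l)"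
      using mult_mat_entry[OF Mk M(1) i] by (simp add: sum_distrib_right)
    finally show ?case .
  qed
  obtain i where i: "i < n" "x $ i \<noteq> 0"
    using x(1,2) by (metis carrier_vecD eq_vecI index_zero_vec)
  have "Bseq (\<lambda>k. \<Sum>j<n. (M ^\<^sub>m k) $$ (i,j) * f j)"
    using bounded i unfolding power_bounded_def by (intro Bseq_sum Bseq_mult Bfun_const) auto
  then obtain b where b: "\<And>k. norm (\<Sum>j<n. (M ^\<^sub>m k) $$ (i,j) * f j) \<le> b" unfolding Bseq_def by blast
  \<comment> \<open>A growth factor above 1 would drive \<open>c ^ k * f i\<close> past the bound
    \<open>b\<close>.\<close>
  have "c \<le> 1"
  proof (rule ccontr)
    assume "\<not> c \<le> 1"
    then obtain k where k: "b / f i < c ^ k" using real_arch_pow by (meson not_le)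
    have "0 < f i" unfolding f_def using i by simp
    then have "b < c ^ k * f i" using k by (simp add: divide_less_eq)
    then show False using pow[OF i(1), of k] b[of k] by simp
  qed
  then show ?thesis unfolding c_def by simp
qed

text \<open>The disc touches the unit circle from inside at 1: expanding the squares bounds the
  squared norm of \<open>a\<close> by \<open>1 - 2 d (1 - Re a)\<close>.\<close>

lemma disc_in_unit_disc:
  fixes a :: complex
  assumes "norm (a - complex_of_real d) \<le> 1 - d" "0 < d"
  shows "norm a < 1 \<or> a = 1"
proof -
  have "(norm (a - complex_of_real d))\<^sup>2 \<le> (1 - d)\<^sup>2"
    using assms by (intro power_mono) auto
  then have *: "(Re a - d)\<^sup>2 + (Im a)\<^sup>2 \<le> (1 - d)\<^sup>2" by (simp add: cmod_power2)
  have "Re a - d \<le> 1 - d"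
    using complex_Re_le_cmod[of "a - complex_of_real d"] assms(1) by simp
  then consider "Re a < 1" | "Re a = 1" by linarith
  then show ?thesis
  proof cases
    case 1
    have "(Re a)\<^sup>2 + (Im a)\<^sup>2 \<le> 1 - 2 * (d * (1 - Re a))"
      using * by (simp add: power2_eq_square algebra_simps)
    also have "\<dots> < 1" using 1 assms(2) by simp
    finally show ?thesis by (simp add: cmod_def)
  next
    case 2
    then have "Im a = 0" using * by simp
    then show ?thesis using 2 by (simp add: complex_eq_iff)
  qed
qed

lemma nonneg_power_bounded_semiconvergent:
  fixes M :: "real mat"
  assumes M: "M \<in> carrier_mat n n" "0\<^sub>m n n \<le> M" and bounded: "power_bounded n M"
    and diag: "\<And>i. i < n \<Longrightarrow> 0 < M $$ (i,i)"
  shows "semiconvergent n M"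
proof -
  \<comment> \<open>The inserted 1 keeps the set nonempty when \<open>n = 0\<close>.\<close>
  define d where "d = Min (insert 1 ((\<lambda>i. M $$ (i,i)) ` {..<n}))"
  have dM: "d \<le> M $$ (i,i)" if "i < n" for i
    unfolding d_def using diag that by auto
  have d0: "0 < d" unfolding d_def using diag by auto
  let ?M = "map_mat complex_of_real M"
  have Mc: "?M \<in> carrier_mat n n" using M by simp
  have entry: "(?M ^\<^sub>m k) $$ (i,j) = complex_of_real ((M ^\<^sub>m k) $$ (i,j))" if "i < n" "j < n" for i j k
    unfolding of_real_hom.mat_hom_pow[OF M(1), symmetric] using carrier_matD[OF pow_carrier_mat[OF M(1), of k]] that by simp
  have "power_bounded n ?M"
    using bounded unfolding power_bounded_def by (auto simp: entry Bseq_def)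
  moreover have "norm a < 1 \<or> a = 1" if "eigenvalue ?M a" for a
    using nonneg_power_bounded_eigenvalue[OF M bounded dM less_imp_le[OF d0] that]
    by (rule disc_in_unit_disc[OF _ d0])
  ultimately have "convergent (\<lambda>k. (?M ^\<^sub>m k) $$ (i,j))" if "i < n" "j < n" for i j
    using powers_convergent_of_spectrum[OF Mc _ _ that] by blast
  then have conv: "convergent (\<lambda>k. complex_of_real ((M ^\<^sub>m k) $$ (i,j)))" if "i < n" "j < n" for i j
    using that by (simp add: entry)
  have "convergent (\<lambda>k. (M ^\<^sub>m k) $$ (i,j))" if "i < n" "j < n" for i j
  proof -
    obtain l where "(\<lambda>k. complex_of_real ((M ^\<^sub>m k) $$ (i,j))) \<longlonglongrightarrow> l"
      using conv[OF \<open>i < n\<close> \<open>j < n\<close>] unfolding convergent_def by blast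
    \<comment> \<open>The powers are real, so the real part of the complex limit is their
      limit.\<close>
    from tendsto_Re[OF this] show ?thesis by (simp add: convergentI)
  qed
  then have lim: "(\<lambda>k. (M ^\<^sub>m k) $$ (i,j)) \<longlonglongrightarrow> lim (\<lambda>k. (M ^\<^sub>m k) $$ (i,j))"
    if "i < n" "j < n" for i j
    using that by (simp only: convergent_LIMSEQ_iff)
  define C where "C = mat n n (\<lambda>(i,j). lim (\<lambda>k. (M ^\<^sub>m k) $$ (i,j)))"
  have "C \<in> carrier_mat n n" and "\<forall>i<n. \<forall>j<n. (\<lambda>k. (M ^\<^sub>m k) $$ (i,j)) \<longlonglongrightarrow> C $$ (i,j)"
    unfolding C_def by (simp_all add: lim del: pow_mat_dim)
  then show ?thesis unfolding semiconvergent_def using M(1) by blast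
qed

section \<open>Algebra of three composed splittings\<close>

text \<open>Identities such as \<open>Ki * A = 1 - Ki * L\<close> turn \<open>G * A\<close> and
  \<open>A * G\<close> into telescoping sums. The sum form of \<open>G\<close> makes its
  nonnegativity visible, the product form in the last claim its invertibility.\<close>

lemma three_splittings_composition:
  fixes A K L U V X Y Ki Ui Xi :: "'a::comm_ring_1 mat"
  assumes K: "K \<in> carrier_mat n n" "Ki \<in> carrier_mat n n" "K * Ki = 1\<^sub>m n" "Ki * K = 1\<^sub>m n"
    and U: "U \<in> carrier_mat n n" "Ui \<in> carrier_mat n n" "U * Ui = 1\<^sub>m n" "Ui * U = 1\<^sub>m n"
    and X: "X \<in> carrier_mat n n" "Xi \<in> carrier_mat n n" "X * Xi = 1\<^sub>m n" "Xi * X = 1\<^sub>m n"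
    and LVY: "L \<in> carrier_mat n n" "V \<in> carrier_mat n n" "Y \<in> carrier_mat n n"
    and A: "A = K - L" "A = U - V" "A = X - Y"
  defines "G \<equiv> Ki + (Xi * (L * Ki) + Xi * (Y * (Ui * (L * Ki))))"
  shows "1\<^sub>m n - G * A = Xi * Y * Ui * V * Ki * L"
    and "1\<^sub>m n - A * G = Y * Xi * V * Ui * L * Ki"
    and "Xi * (K + X - A + Y * Ui * L) * Ki = G"
proof -
  note c[simp] = K(1,2) U(1,2) X(1,2) LVY
  have Ac[simp]: "A \<in> carrier_mat n n" unfolding A(1) by (rule minus_carrier_mat) simp
  have mc[simp]: "B * C \<in> carrier_mat n n" if "B \<in> carrier_mat n n" "C \<in> carrier_mat n n" for B C :: "'a mat"
    using that by auto
  have assoc: "B * C * D = B * (C * D)" if "B \<in> carrier_mat n n" "C \<in> carrier_mat n n" "D \<in> carrier_mat n n" for B C D :: "'a mat"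
    using that by simp
  have dl: "B * (C - D) = B * C - B * D" if "B \<in> carrier_mat n n" "C \<in> carrier_mat n n" "D \<in> carrier_mat n n" for B C D :: "'a mat"
    using that mult_minus_distrib_mat by blast
  have dr: "(C - D) * B = C * B - D * B" if "B \<in> carrier_mat n n" "C \<in> carrier_mat n n" "D \<in> carrier_mat n n" for B C D :: "'a mat"
    using that minus_mult_distrib_mat by blast
  have one: "B * 1\<^sub>m n = B" "1\<^sub>m n * B = B" if "B \<in> carrier_mat n n" for B :: "'a mat"
    using that by simp_all
  have cancel: "B - (B - C) = C" if "B \<in> carrier_mat n n" "C \<in> carrier_mat n n" for B C :: "'a mat"
    using that by (intro eq_matI) auto
  have telescope: "1\<^sub>m n - B + ((B - C) + (C - D)) = 1\<^sub>m n - D"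
    if "B \<in> carrier_mat n n" "C \<in> carrier_mat n n" "D \<in> carrier_mat n n" for B C D :: "'a mat"
    using that by (intro eq_matI) auto
  have KiA: "Ki * A = 1\<^sub>m n - Ki * L" unfolding A(1) using dl[of Ki K L] K by simp
  have AKi: "A * Ki = 1\<^sub>m n - L * Ki" unfolding A(1) using dr[of Ki K L] K by simp
  have UiA: "Ui * A = 1\<^sub>m n - Ui * V" unfolding A(2) using dl[of Ui U V] U by simp
  have AUi: "A * Ui = 1\<^sub>m n - V * Ui" unfolding A(2) using dr[of Ui U V] U by simp
  have XiA: "Xi * A = 1\<^sub>m n - Xi * Y" unfolding A(3) using dl[of Xi X Y] X by simp
  have AXi: "A * Xi = 1\<^sub>m n - Y * Xi" unfolding A(3) using dr[of Xi X Y] X by simp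
  \<comment> \<open>Both sides equal \<open>L - L Ki L\<close>. Moving \<open>A\<close> to the left
    lets it meet \<open>Xi\<close> and \<open>Ui\<close>; \<open>YXiA\<close> below does the same
    for \<open>A * G\<close>, in the other direction.\<close>
  have LKiA: "L * (Ki * A) = A * (Ki * L)"
    unfolding KiA assoc[symmetric, OF Ac K(2) LVY(1)] AKi
    by (simp add: dl dr assoc one)
  have YXiA: "Y * (Xi * A) = A * (Xi * Y)"
    unfolding XiA assoc[symmetric, OF Ac X(2) LVY(3)] AXi
    by (simp add: dl dr assoc one)
  have "G * A = Ki * A + (Xi * (L * (Ki * A)) + Xi * (Y * (Ui * (L * (Ki * A)))))"
    unfolding G_def by (simp add: assoc add_mult_distrib_mat[of _ n n _ _ n])
  also have "\<dots> = Ki * A + ((Xi * A) * (Ki * L) + Xi * (Y * ((Ui * A) * (Ki * L))))"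
    unfolding LKiA by (simp add: assoc)
  also have "\<dots> = (1\<^sub>m n - Ki * L) + ((Ki * L - Xi * (Y * (Ki * L))) + (Xi * (Y * (Ki * L)) - Xi * (Y * (Ui * (V * (Ki * L))))))"
    unfolding KiA XiA UiA by (simp add: dl dr assoc one)
  also have "\<dots> = 1\<^sub>m n - Xi * (Y * (Ui * (V * (Ki * L))))"
    by (rule telescope) simp_all
  finally show "1\<^sub>m n - G * A = Xi * Y * Ui * V * Ki * L"
    by (simp add: cancel assoc)
  have "A * G = A * Ki + ((A * Xi) * (L * Ki) + (A * (Xi * Y)) * (Ui * (L * Ki)))"
    unfolding G_def by (simp add: assoc mult_add_distrib_mat[of _ n n _ n])
  also have "\<dots> = A * Ki + ((A * Xi) * (L * Ki) + Y * (Xi * ((A * Ui) * (L * Ki))))"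
    unfolding YXiA[symmetric] by (simp add: assoc)
  also have "\<dots> = (1\<^sub>m n - L * Ki) + ((L * Ki - Y * (Xi * (L * Ki))) + (Y * (Xi * (L * Ki)) - Y * (Xi * (V * (Ui * (L * Ki))))))"
    unfolding AKi AXi AUi by (simp add: dl dr assoc one)
  also have "\<dots> = 1\<^sub>m n - Y * (Xi * (V * (Ui * (L * Ki))))"
    by (rule telescope) simp_all
  finally show "1\<^sub>m n - A * G = Y * Xi * V * Ui * L * Ki"
    by (simp add: cancel assoc)
  have "K + X - A + Y * Ui * L = X + (L + Y * (Ui * L))"
  proof -
    have "B + X - (B - C) + D = X + (C + D)"
      if "B \<in> carrier_mat n n" "C \<in> carrier_mat n n" "D \<in> carrier_mat n n" for B C D :: "'a mat"
      using that carrier_matD[OF X(1)] by (intro eq_matI) auto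
    from this[of K L "Y * (Ui * L)"] show ?thesis unfolding A(1) by (simp add: assoc)
  qed
  then show "Xi * (K + X - A + Y * Ui * L) * Ki = G"
    unfolding G_def by (simp add: assoc one X mult_add_distrib_mat[of _ n n _ n] add_mult_distrib_mat[of _ n n _ _ n]
      flip: assoc[of Xi X Ki])
qed

section \<open>Semiconvergence of the iteration matrix\<close>

text \<open>From \<open>G (1 - A G) = (1 - G A) G\<close> the two matrices are similar. Boundedness
  is available for \<open>1 - A G\<close>, while the diagonal hypothesis concerns
  \<open>1 - G A\<close>.\<close>

lemma weak_regular_semiconvergent:
  fixes W G Gi :: "real mat"
  assumes W: "W \<in> carrier_mat n n" "0\<^sub>m n n \<le> W" "semiconvergent n W"
    and G: "G \<in> carrier_mat n n" "0\<^sub>m n n \<le> G"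
    and Gi: "Gi \<in> carrier_mat n n" "Gi * G = 1\<^sub>m n" "G * Gi = 1\<^sub>m n"
    and T: "0\<^sub>m n n \<le> 1\<^sub>m n - G * (1\<^sub>m n - W)"
    and T': "0\<^sub>m n n \<le> 1\<^sub>m n - (1\<^sub>m n - W) * G"
    and diag: "\<And>i. i < n \<Longrightarrow> 0 < (1\<^sub>m n - G * (1\<^sub>m n - W)) $$ (i,i)"
  shows "semiconvergent n (1\<^sub>m n - G * (1\<^sub>m n - W))"
proof -
  define A where "A = 1\<^sub>m n - W"
  have Ac: "A \<in> carrier_mat n n" unfolding A_def using W(1) by (rule minus_carrier_mat)
  note GA = mult_carrier_mat[OF G(1) Ac] and AG = mult_carrier_mat[OF Ac G(1)]
  have Tc: "1\<^sub>m n - G * A \<in> carrier_mat n n" "1\<^sub>m n - A * G \<in> carrier_mat n n"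
    using minus_carrier_mat[OF GA] minus_carrier_mat[OF AG] by auto
  obtain C where C: "C \<in> carrier_mat n n"
    and lim: "\<And>i j. i < n \<Longrightarrow> j < n \<Longrightarrow> (\<lambda>k. (W ^\<^sub>m k) $$ (i,j)) \<longlonglongrightarrow> C $$ (i,j)"
    using W(3) unfolding semiconvergent_def by blast
  have "G * (1\<^sub>m n - A * G) = G - G * (A * G)"
    using mult_minus_distrib_mat[OF G(1) one_carrier_mat AG] G(1) by simp
  also have "\<dots> = (1\<^sub>m n - G * A) * G"
    using minus_mult_distrib_mat[OF one_carrier_mat GA G(1)] G(1) assoc_mult_mat[OF G(1) Ac G(1)] by simp
  finally have "G * (1\<^sub>m n - A * G) * Gi = 1\<^sub>m n - G * A"
    using assoc_mult_mat[OF Tc(1) G(1) Gi(1)] Gi(3) right_mult_one_mat[OF Tc(1)] by simp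
  then have "similar_mat_wit (1\<^sub>m n - G * A) (1\<^sub>m n - A * G) G Gi"
    using Tc G(1) Gi by (intro similar_mat_witI[where n = n]) simp_all
  then have "power_bounded n (1\<^sub>m n - G * A)"
    using weak_regular_power_bounded[OF W(1,2) C lim G Gi(1,2) T T', folded A_def]
    by (rule power_bounded_similar[OF _ Tc(2)])
  then show ?thesis
    using nonneg_power_bounded_semiconvergent[OF Tc(1) T[folded A_def]] diag unfolding A_def by blast
qed

lemma regular_splittingD:
  assumes "regular_splitting n A U V"
  shows "U \<in> carrier_mat n n" "V \<in> carrier_mat n n" "A = U - V" "invertible_mat U"
    "0\<^sub>m n n \<le> mat_inv U" "0\<^sub>m n n \<le> V"
  using assms unfolding regular_splitting_def splitting_def by auto

theorem theorem4p5:
  fixes n :: nat and A K L U V X Y :: "real mat"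
  assumes "A \<in> carrier_mat n n"
    and "M_matrix n A" and "property_c n A"
    and "regular_splitting n A K L"
    and "regular_splitting n A U V"
    and "regular_splitting n A X Y"
    and "invertible_mat (K + X - A + Y * mat_inv U * L)"
    and "\<forall>i<n. (mat_inv X * Y * mat_inv U * V * mat_inv K * L) $$ (i,i) > 0"
  shows "semiconvergent n (mat_inv X * Y * mat_inv U * V * mat_inv K * L)"
proof -
  note Ac = \<open>A \<in> carrier_mat n n\<close>
  note KL = regular_splittingD[OF \<open>regular_splitting n A K L\<close>]
  note UV = regular_splittingD[OF \<open>regular_splitting n A U V\<close>]
  note XY = regular_splittingD[OF \<open>regular_splitting n A X Y\<close>]
  note Ki = mat_inv[OF KL(1,4)] and Ui = mat_inv[OF UV(1,4)] and Xi = mat_inv[OF XY(1,4)]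
  define M where "M = K + X - A + Y * mat_inv U * L"
  define G where "G = mat_inv K + (mat_inv X * (L * mat_inv K) + mat_inv X * (Y * (mat_inv U * (L * mat_inv K))))"
  note splitting = three_splittings_composition[OF KL(1) Ki(3) Ki(1,2) UV(1) Ui(3) Ui(1,2) XY(1) Xi(3) Xi(1,2)
      KL(2) UV(2) XY(2) KL(3) UV(3) XY(3), folded G_def M_def]
  have Mc: "M \<in> carrier_mat n n"
    unfolding M_def using KL XY Ac Ui by (intro add_carrier_mat mult_carrier_mat[of _ n n]) auto
  note Mi = mat_inv[OF Mc \<open>invertible_mat (K + X - A + Y * mat_inv U * L)\<close>[folded M_def]]
  have Gc: "G \<in> carrier_mat n n"
    unfolding G_def using KL XY Ki Ui Xi by (intro add_carrier_mat mult_carrier_mat[of _ n n]) auto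
  have G0: "0\<^sub>m n n \<le> G"
    unfolding G_def using KL XY UV Ki Ui Xi by (intro nonneg_mat_add nonneg_mat_mult[of _ n n]) auto
  \<comment> \<open>The inverse of \<open>G\<close>, read off from its product form with the factors
    inverted and reversed.\<close>
  define H where "H = K * mat_inv M * X"
  have Hc: "H \<in> carrier_mat n n"
    unfolding H_def using KL XY Mi by (intro mult_carrier_mat[of _ n n])
  have "H * G = K * mat_inv M * (X * mat_inv X) * M * mat_inv K"
    unfolding H_def splitting(3)[symmetric]
    using KL(1) Mi(3) XY(1) Xi(3) Mc Ki(3) by (simp add: assoc_mult_mat[of _ n n _ n _ n])
  also have "\<dots> = K * (mat_inv M * M) * mat_inv K"
    unfolding Xi(1) using KL(1) Mi(3) Mc by (simp add: assoc_mult_mat[of _ n n _ n _ n])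
  also have "\<dots> = 1\<^sub>m n" unfolding Mi(2) using KL(1) Ki by simp
  finally have HG: "H * G = 1\<^sub>m n" .
  have GH: "G * H = 1\<^sub>m n" by (rule mat_mult_left_right_inverse[OF Hc Gc HG])

  obtain s B where B: "B \<in> carrier_mat n n" "A = s \<cdot>\<^sub>m 1\<^sub>m n - B" "0\<^sub>m n n \<le> B" "0 < s"
    and semi: "semiconvergent n (inverse s \<cdot>\<^sub>m B)"
    using \<open>property_c n A\<close> unfolding property_c_def M_representation_def by blast
  define W where "W = inverse s \<cdot>\<^sub>m B"
  have W: "W \<in> carrier_mat n n" "0\<^sub>m n n \<le> W"
    unfolding W_def using B by (auto simp: less_eq_mat_def)
  have IW: "1\<^sub>m n - W \<in> carrier_mat n n" using W(1) by (rule minus_carrier_mat)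
  have A: "s \<cdot>\<^sub>m (1\<^sub>m n - W) = A"
    unfolding W_def B(2) using B(1,4) by (intro eq_matI) (auto simp: right_diff_distrib)
  \<comment> \<open>Since \<open>A = s (1 - W)\<close>, moving the positive factor \<open>s\<close>
    to \<open>G\<close> leaves both products with \<open>A\<close> unchanged.\<close>
  have GA: "(s \<cdot>\<^sub>m G) * (1\<^sub>m n - W) = G * A"
    unfolding A[symmetric] mult_smult_assoc_mat[OF Gc IW] mult_smult_distrib[OF Gc IW] ..
  have AG: "(1\<^sub>m n - W) * (s \<cdot>\<^sub>m G) = A * G"
    unfolding A[symmetric] mult_smult_assoc_mat[OF IW Gc] mult_smult_distrib[OF IW Gc] ..
  have unscale: "inverse s \<cdot>\<^sub>m (s \<cdot>\<^sub>m Z) = Z" "s \<cdot>\<^sub>m (inverse s \<cdot>\<^sub>m Z) = Z" for Z :: "real mat"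
    using B(4) by (auto intro!: eq_matI)
  have inv: "(inverse s \<cdot>\<^sub>m H) * (s \<cdot>\<^sub>m G) = 1\<^sub>m n" "(s \<cdot>\<^sub>m G) * (inverse s \<cdot>\<^sub>m H) = 1\<^sub>m n"
    unfolding mult_smult_assoc_mat[OF Hc smult_carrier_mat[OF Gc]] mult_smult_distrib[OF Hc Gc] HG
      mult_smult_assoc_mat[OF Gc smult_carrier_mat[OF Hc]] mult_smult_distrib[OF Gc Hc] GH
    by (rule unscale)+
  have "semiconvergent n (1\<^sub>m n - (s \<cdot>\<^sub>m G) * (1\<^sub>m n - W))"
  proof (rule weak_regular_semiconvergent)
    show "0\<^sub>m n n \<le> s \<cdot>\<^sub>m G" using G0 Gc B(4) by (auto simp: less_eq_mat_def)
    show "0\<^sub>m n n \<le> 1\<^sub>m n - (s \<cdot>\<^sub>m G) * (1\<^sub>m n - W)"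
      unfolding GA splitting(1) using KL XY UV Ki Ui Xi by (intro nonneg_mat_mult[of _ n n] mult_carrier_mat[of _ n n]) auto
    show "0\<^sub>m n n \<le> 1\<^sub>m n - (1\<^sub>m n - W) * (s \<cdot>\<^sub>m G)"
      unfolding AG splitting(2) using KL XY UV Ki Ui Xi by (intro nonneg_mat_mult[of _ n n] mult_carrier_mat[of _ n n]) auto
    show "0 < (1\<^sub>m n - (s \<cdot>\<^sub>m G) * (1\<^sub>m n - W)) $$ (i,i)" if "i < n" for i
      unfolding GA splitting(1) using assms(8) that by blast
  qed (use W semi inv Gc Hc in \<open>auto simp: W_def\<close>)
  then show ?thesis unfolding GA splitting(1) .
qed

end
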